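(* Let $M=(\mathcal{S},\mathcal{A},r,P,\gamma,\rho)$ be a finite discounted Markov decision process, $\phi$ a state aggregation of $\mathcal{S}$, $\alpha\in[0,1]$ and $\pi_1\in\Pi$. Suppose Frank-Wolfe policy gradient and soft API with adaptive weighting are both applied with the same inputs $(\alpha,\pi_1,\phi)$, and suppose that, at every iteration, the maximization problem over $\Pi_\phi$ defining $\tilde{\pi}_{t+1}$ in Frank-Wolfe policy gradient and the maximization problems over $\mathcal{A}$ (one for each $s\in\mathcal{S}$) defining $\tilde{\pi}_{t+1}(s)$ in soft API with adaptive weighting have unique solutions. Then the two algorithms produce identical sequences of policies $\{\pi_t\}_{t\ge1}$.
   Context: MDP. $\mathcal{S}$ and $\mathcal{A}$ are finite nonempty sets of states and actions, $r:\mathcal{S}\times\mathcal{A}\to\mathbb{R}$ is the reward function, $P(s'\mid s,a)$ is the probability of moving to $s'$ when action $a$ is taken in state $s$, $\gamma\in(0,1)$ is the discount factor, and $\rho$ is a probability distribution on $\mathcal{S}$ (initial distribution). Policies and values. $\Pi$ is the set of stationary randomized policies $\pi:\mathcal{S}\to\Delta(\mathcal{A})$, where $\Delta(\mathcal{A})$ is the set of probability distributions on $\mathcal{A}$ (an action is identified with its point mass); $\pi(s,a)$ is the probability of action $a$ in state $s$, and $\pi$ is identified with a vector in $\mathbb{R}^{|\mathcal{S}|\cdot|\mathcal{A}|}$. $V_\pi(s)=\mathbb{E}_s^\pi[\sum_{t=0}^\infty\gamma^t r(s_t,a_t)]$ and $Q_\pi(s,a)=r(s,a)+\gamma\sum_{s'}P(s'\mid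 s,a)V_\pi(s')$. Objective and occupancy. $J(\pi)=(1-\gamma)\sum_s\rho(s)V_\pi(s)$. Writing $r_\pi(s)=\sum_a\pi(s,a)r(s,a)$ and $P_\pi(s,s')=\sum_a\pi(s,a)P(s'\mid s,a)$, one has $J(\pi)=(1-\gamma)\rho(I-\gamma P_\pi)^{-1}r_\pi$, which extends smoothly to a neighborhood of $\Pi$ in $\mathbb{R}^{|\mathcal{S}|\cdot|\mathcal{A}|}$; $\nabla J$ is its gradient and $\langle\cdot,\cdot\rangle$ the Euclidean inner product. The discounted state occupancy measure is $\eta_\pi=(1-\gamma)\sum_{t=0}^\infty\gamma^t\rho P_\pi^t$, with $\rho$ a row vector. State aggregation. A state aggregation is a function $\phi:\mathcal{S}\to\{1,\dots,m\}$. $\Pi_\phi=\{\pi\in\Pi:\pi(s)=\pi(s')\text{ whenever }\phi(s)=\phi(s')\}$ and $\mathcal{Q}_\phi=\{Q\in\mathbb{R}^{|\mathcal{S}|\times|\mathcal{A}|}:Q(s,a)=Q(s',a)\text{ for all }a\in\mathcal{A}\text{ whenever }\phi(s)=\phi(s')\}$. For $w\in\Delta(\mathcal{S})$ (a probability distribution on $\mathcal{S}$), $\|Q\|_{2,w\times1}=\sqrt{\sum_s\sum_a w(s)Q(s,a)^2}$. Frank-Wolfe policy gradient (inputs $\alpha,\pi_1,\phi$): for $t=1,2,\dots$, set $\tilde{\pi}_{t+1}=\arg\max_{\pi\in\Pi_\phi}\langle\nabla J(\pi_t),\pi-\pi_t\rangle$ and then $\pi_{t+1}=\alpha\tilde{\pi}_{t+1}+(1-\alpha)\pi_t$.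 Soft API with adaptive weighting (inputs $\alpha,\pi_1,\phi$): for $t=1,2,\dots$, choose $\hat{Q}_t\in\arg\min_{\hat{Q}\in\mathcal{Q}_\phi}\|\hat{Q}-Q_{\pi_t}\|_{2,\eta_{\pi_t}\times1}$, choose $\tilde{\pi}_{t+1}(s)\in\arg\max_{a\in\mathcal{A}}\hat{Q}_t(s,a)$ for every $s\in\mathcal{S}$, and then set $\pi_{t+1}=\alpha\tilde{\pi}_{t+1}+(1-\alpha)\pi_t$. *)

theory Defs
  imports "HOL-Analysis.Analysis" "HOL-Probability.Probability"
begin

record ('s, 'a) mdp =
  reward :: "'s \<Rightarrow> 'a \<Rightarrow> real"
  trans :: "'s \<Rightarrow> 'a \<Rightarrow> 's pmf"
  disc :: real
  init :: "'s pmf"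

definition finite_mdp :: "('s::finite, 'a::finite) mdp \<Rightarrow> bool" where
  "finite_mdp M \<longleftrightarrow> 0 < disc M \<and> disc M < 1"

definition policies :: "(real ^ 'a::finite ^ 's::finite) set" where
  "policies = {\<pi>. \<forall>s. (\<forall>a. 0 \<le> \<pi> $ s $ a) \<and> (\<Sum>a\<in>UNIV. \<pi> $ s $ a) = 1}"


(* Meaningful only for \<pi> in policies; hence so are all notions defined through trajectories. *)
definition policy_pmf :: "real ^ 'a::finite ^ 's::finite \<Rightarrow> 's \<Rightarrow> 'a pmf" where
  "policy_pmf \<pi> s = embed_pmf (\<lambda>a. \<pi> $ s $ a)"

definition state_action_pmf :: "real ^ 'a::finite ^ 's::finite \<Rightarrow> 's pmf \<Rightarrow> ('s \<times> 'a) pmf" where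
  "state_action_pmf \<pi> D = bind_pmf D (\<lambda>s. map_pmf (Pair s) (policy_pmf \<pi> s))"

(* Conditional law of (s_t, a_t) given the history h 0, ..., h (t - 1), when starting in s. *)
definition step_kernel :: "('s::finite, 'a::finite) mdp \<Rightarrow> real ^ 'a ^ 's \<Rightarrow> 's
    \<Rightarrow> nat \<Rightarrow> (nat \<Rightarrow> 's \<times> 'a) \<Rightarrow> ('s \<times> 'a) measure" where
  "step_kernel M \<pi> s t h = measure_pmf (state_action_pmf \<pi>
     (case t of 0 \<Rightarrow> return_pmf s | Suc n \<Rightarrow> trans M (fst (h n)) (snd (h n))))"

(* The law of (s_0, a_0), (s_1, a_1), ..., by the Ionescu-Tulcea theorem. *)
definition trajectory :: "('s::finite, 'a::finite) mdp \<Rightarrow> real ^ 'a ^ 's \<Rightarrow> 's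
    \<Rightarrow> (nat \<Rightarrow> 's \<times> 'a) measure" where
  "trajectory M \<pi> s = projective_family.lim UNIV
     (Ionescu_Tulcea.CI (step_kernel M \<pi> s) (\<lambda>_. count_space UNIV)) (\<lambda>_. count_space UNIV)"

definition state_value :: "('s::finite, 'a::finite) mdp \<Rightarrow> real ^ 'a ^ 's \<Rightarrow> 's \<Rightarrow> real" where
  "state_value M \<pi> s =
     (\<integral>\<omega>. (\<Sum>t. disc M ^ t * reward M (fst (\<omega> t)) (snd (\<omega> t))) \<partial>trajectory M \<pi> s)"

definition action_value :: "('s::finite, 'a::finite) mdp \<Rightarrow> real ^ 'a ^ 's \<Rightarrow> real ^ 'a ^ 's" where
  "action_value M \<pi> = (\<chi> s a. reward M s a
     + disc M * (\<Sum>s'\<in>UNIV. pmf (trans M s a) s' * state_value M \<pi> s'))"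


definition init_vec :: "('s::finite, 'a::finite) mdp \<Rightarrow> real ^ 's" where
  "init_vec M = (\<chi> s. pmf (init M) s)"

definition policy_reward :: "('s::finite, 'a::finite) mdp \<Rightarrow> real ^ 'a ^ 's \<Rightarrow> real ^ 's" where
  "policy_reward M \<pi> = (\<chi> s. \<Sum>a\<in>UNIV. \<pi> $ s $ a * reward M s a)"

definition policy_trans :: "('s::finite, 'a::finite) mdp \<Rightarrow> real ^ 'a ^ 's \<Rightarrow> real ^ 's ^ 's" where
  "policy_trans M \<pi> = (\<chi> s s'. \<Sum>a\<in>UNIV. \<pi> $ s $ a * pmf (trans M s a) s')"

definition objective :: "('s::finite, 'a::finite) mdp \<Rightarrow> real ^ 'a ^ 's \<Rightarrow> real" where
  "objective M \<pi> = (1 - disc M) * (\<Sum>s\<in>UNIV. pmf (init M) s * state_value M \<pi> s)"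

(* The closed form of the objective, which also makes sense near policies: see objective_eq_ext. *)
definition objective_ext :: "('s::finite, 'a::finite) mdp \<Rightarrow> real ^ 'a ^ 's \<Rightarrow> real" where
  "objective_ext M \<pi> = (1 - disc M) *
     ((init_vec M v* matrix_inv (mat 1 - disc M *\<^sub>R policy_trans M \<pi>)) \<bullet> policy_reward M \<pi>)"


lemma Ionescu_Tulcea_step_kernel:
  "Ionescu_Tulcea (step_kernel M \<pi> s) (\<lambda>_. count_space UNIV)"
proof (rule Ionescu_Tulcea.intro)
  fix i :: nat
  show "step_kernel M \<pi> s i \<in> measurable (PiM {0..<i} (\<lambda>_. count_space UNIV)) (subprob_algebra (count_space UNIV))"
  proof (cases i)
    case 0
    then show ?thesis
      unfolding step_kernel_def by (auto intro!: measurable_const measure_pmf_in_subprob_algebra)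
  next
    case (Suc n)
    have "(\<lambda>h. h n) \<in> measurable (PiM {0..<i} (\<lambda>_. count_space (UNIV::('a \<times> 'b) set))) (count_space UNIV)"
      by (rule measurable_component_singleton) (simp add: Suc)
    moreover have "(\<lambda>x. measure_pmf (state_action_pmf \<pi> (trans M (fst x) (snd x))))
       \<in> measurable (count_space UNIV) (subprob_algebra (count_space UNIV))"
      by (auto intro!: measure_pmf_in_subprob_algebra)
    ultimately have "(\<lambda>x. measure_pmf (state_action_pmf \<pi> (trans M (fst x) (snd x)))) \<circ> (\<lambda>h. h n)
        \<in> measurable (PiM {0..<i} (\<lambda>_. count_space UNIV)) (subprob_algebra (count_space UNIV))"
      by (rule measurable_comp)
    then show ?thesis
      unfolding step_kernel_def by (simp add: Suc comp_def)
  qed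
qed (unfold step_kernel_def, rule prob_space_measure_pmf)

primrec state_pmf :: "('s::finite, 'a::finite) mdp \<Rightarrow> real ^ 'a ^ 's \<Rightarrow> 's \<Rightarrow> nat \<Rightarrow> 's pmf" where
  "state_pmf M \<pi> s 0 = return_pmf s"
| "state_pmf M \<pi> s (Suc t) =
     bind_pmf (state_action_pmf \<pi> (state_pmf M \<pi> s t)) (\<lambda>x. trans M (fst x) (snd x))"

lemma state_action_pmf_bind:
  "state_action_pmf \<pi> (bind_pmf D f) = bind_pmf D (\<lambda>x. state_action_pmf \<pi> (f x))"
  by (simp add: state_action_pmf_def bind_assoc_pmf)

lemma nn_integral_C_coordinate:
  fixes f :: "'s::finite \<times> 'a::finite \<Rightarrow> ennreal"
  shows "(\<integral>\<^sup>+h. f (h t) \<partial>Ionescu_Tulcea.C (step_kernel M \<pi> s) (\<lambda>_. count_space UNIV) 0 (Suc t) (\<lambda>_. undefined))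
    = (\<integral>\<^sup>+x. f x \<partial>state_action_pmf \<pi> (state_pmf M \<pi> s t))"
proof (induction t arbitrary: f)
  interpret IT: Ionescu_Tulcea "step_kernel M \<pi> s" "\<lambda>_. count_space (UNIV :: ('s \<times> 'a) set)"
    by (rule Ionescu_Tulcea_step_kernel)
  have meas: "(\<lambda>h. g (h n)) \<in> borel_measurable (PiM {0..<Suc n} (\<lambda>_. count_space (UNIV :: ('s \<times> 'a) set)))"
    for n and g :: "'s \<times> 'a \<Rightarrow> ennreal"
    by (rule measurable_compose[OF measurable_component_singleton[of n]]) auto
  have step: "(\<integral>\<^sup>+h. f (h n) \<partial>IT.C 0 (Suc n) (\<lambda>_. undefined))
      = (\<integral>\<^sup>+h. \<integral>\<^sup>+x. f x \<partial>step_kernel M \<pi> s n h \<partial>IT.C 0 n (\<lambda>_. undefined))" for n f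
  proof -
    have sp: "space (IT.C 0 n (\<lambda>_. undefined)) = space (PiM {0..<n} (\<lambda>_. count_space UNIV))"
      by (subst IT.space_C) (auto simp: space_PiM)
    have "(\<integral>\<^sup>+h. f (h n) \<partial>IT.C 0 (Suc n) (\<lambda>_. undefined))
      = (\<integral>\<^sup>+h. (\<integral>\<^sup>+h'. f (h' n) \<partial>IT.eP n h) \<partial>IT.C 0 n (\<lambda>_. undefined))"
      unfolding IT.C.simps add_0
      by (rule nn_integral_bind[OF meas])
        (subst measurable_cong_sets[OF IT.sets_C refl], auto simp: space_PiM)
    also have "\<dots> = (\<integral>\<^sup>+h. \<integral>\<^sup>+x. f x \<partial>step_kernel M \<pi> s n h \<partial>IT.C 0 n (\<lambda>_. undefined))"
      by (rule nn_integral_cong) (simp add: sp IT.nn_integral_eP[OF _ meas])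
    finally show ?thesis .
  qed
  have u: "(\<lambda>_. undefined) \<in> space (PiM {0..<0} (\<lambda>_. count_space (UNIV :: ('s \<times> 'a) set)))"
    by (simp add: space_PiM PiE_def extensional_def)
  {
    case 0
    interpret C: prob_space "IT.C 0 0 (\<lambda>_. undefined)"
      by (rule IT.prob_space_C[OF u])
    show ?case
      unfolding step by (simp add: step_kernel_def C.emeasure_space_1 del: IT.C.simps)
  next
    case (Suc t)
    have "(\<integral>\<^sup>+h. f (h (Suc t)) \<partial>IT.C 0 (Suc (Suc t)) (\<lambda>_. undefined))
       = (\<integral>\<^sup>+x. \<integral>\<^sup>+y. f y \<partial>state_action_pmf \<pi> (trans M (fst x) (snd x)) \<partial>state_action_pmf \<pi> (state_pmf M \<pi> s t))"
      unfolding step[where n="Suc t"]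
      by (subst Suc.IH[symmetric]) (simp add: step_kernel_def[of M \<pi> s "Suc t"] del: IT.C.simps)
    also have "\<dots> = (\<integral>\<^sup>+x. f x \<partial>state_action_pmf \<pi> (state_pmf M \<pi> s (Suc t)))"
      by (simp add: state_action_pmf_bind nn_integral_bind_pmf)
    finally show ?case .
  }
qed

lemma distr_trajectory_coordinate:
  fixes M :: "('s::finite, 'a::finite) mdp"
  shows "distr (trajectory M \<pi> s) (count_space UNIV) (\<lambda>\<omega>. \<omega> t)
    = measure_pmf (state_action_pmf \<pi> (state_pmf M \<pi> s t))" (is "?L = ?R")
proof -
  interpret IT: Ionescu_Tulcea "step_kernel M \<pi> s" "\<lambda>_. count_space (UNIV :: ('s \<times> 'a) set)"
    by (rule Ionescu_Tulcea_step_kernel)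
  let ?N = "\<lambda>_::nat. count_space (UNIV :: ('s \<times> 'a) set)"
  let ?J = "{0..<Suc t}"
  have up: "IT.up_to ?J = Suc t"
    by (rule antisym) (auto simp: IT.up_to_iff Suc_le_eq IT.up_to_less)
  have tr: "trajectory M \<pi> s = IT.PF.lim" by (simp add: trajectory_def)
  have sets_tr: "sets IT.PF.lim = sets (PiM UNIV ?N)" by (rule IT.PF.sets_lim)
  have cJ: "(\<lambda>h. h t) \<in> measurable (PiM ?J ?N) (count_space UNIV)"
    by (rule measurable_component_singleton) simp
  have rU: "(\<lambda>h. restrict h ?J) \<in> measurable IT.PF.lim (PiM ?J ?N)"
    by (subst measurable_cong_sets[OF sets_tr refl]) (rule measurable_restrict_subset, simp)
  have sC: "sets (IT.C 0 (Suc t) (\<lambda>_. undefined)) = sets (PiM ?J ?N)"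
    by (subst IT.sets_C) (auto simp: space_PiM)
  have rC: "(\<lambda>h. restrict h ?J) \<in> measurable (IT.C 0 (Suc t) (\<lambda>_. undefined)) (PiM ?J ?N)"
    by (subst measurable_cong_sets[OF sC refl]) (rule measurable_restrict_subset, simp)
  have "?L = distr (distr IT.PF.lim (PiM ?J ?N) (\<lambda>h. restrict h ?J)) (count_space UNIV) (\<lambda>h. h t)"
    unfolding tr by (subst distr_distr[OF cJ rU]) (simp add: comp_def)
  also have "\<dots> = distr (IT.C 0 (Suc t) (\<lambda>_. undefined)) (count_space UNIV) (\<lambda>h. h t)"
    unfolding IT.distr_lim[OF finite_atLeastLessThan] IT.CI_def up
    by (subst distr_distr[OF cJ rC]) (simp add: comp_def)
  finally have L: "?L = distr (IT.C 0 (Suc t) (\<lambda>_. undefined)) (count_space UNIV) (\<lambda>h. h t)" .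
  have cC: "(\<lambda>h. h t) \<in> measurable (IT.C 0 (Suc t) (\<lambda>_. undefined)) (count_space UNIV)"
    by (subst measurable_cong_sets[OF sC refl]) (rule cJ)
  show ?thesis
  proof (rule measure_eqI)
    fix A :: "('s \<times> 'a) set"
    have "emeasure ?L A = (\<integral>\<^sup>+x. indicator A x \<partial>?L)" by (simp add: nn_integral_indicator)
    also have "\<dots> = (\<integral>\<^sup>+h. indicator A (h t) \<partial>IT.C 0 (Suc t) (\<lambda>_. undefined))"
      unfolding L by (rule nn_integral_distr[OF cC]) simp
    also have "\<dots> = emeasure ?R A"
      unfolding nn_integral_C_coordinate by simp
    finally show "emeasure ?L A = emeasure ?R A" .
  qed simp
qed

lemma pmf_policy_pmf:
  fixes \<pi> :: "real ^ 'a::finite ^ 's::finite"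
  assumes "\<pi> \<in> policies"
  shows "pmf (policy_pmf \<pi> s) a = \<pi> $ s $ a"
  unfolding policy_pmf_def
proof (rule pmf_embed_pmf)
  show "\<And>x. 0 \<le> \<pi> $ s $ x" using assms by (auto simp: policies_def)
  have "(\<integral>\<^sup>+x. ennreal (\<pi> $ s $ x) \<partial>count_space UNIV) = (\<Sum>x\<in>UNIV. ennreal (\<pi> $ s $ x))"
    by (rule nn_integral_count_space_finite) simp
  also have "\<dots> = ennreal (\<Sum>x\<in>UNIV. \<pi> $ s $ x)"
    using assms by (intro sum_ennreal) (auto simp: policies_def)
  also have "\<dots> = 1" using assms by (simp add: policies_def)
  finally show "(\<integral>\<^sup>+x. ennreal (\<pi> $ s $ x) \<partial>count_space UNIV) = 1" .
qed

lemma expectation_state_action_pmf: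
  fixes D :: "'s::finite pmf" and \<pi> :: "real ^ 'a::finite ^ 's" and f :: "'s \<times> 'a \<Rightarrow> real"
  assumes "\<pi> \<in> policies"
  shows "measure_pmf.expectation (state_action_pmf \<pi> D) f
    = (\<Sum>s\<in>UNIV. pmf D s * (\<Sum>a\<in>UNIV. \<pi> $ s $ a * f (s, a)))"
proof -
  have "measure_pmf.expectation (state_action_pmf \<pi> D) f
     = (\<Sum>s\<in>UNIV. pmf D s * measure_pmf.expectation (map_pmf (Pair s) (policy_pmf \<pi> s)) f)"
    unfolding state_action_pmf_def
    by (subst pmf_expectation_bind[where A=UNIV]) auto
  also have "\<dots> = (\<Sum>s\<in>UNIV. pmf D s * (\<Sum>a\<in>UNIV. \<pi> $ s $ a * f (s, a)))"
    by (simp add: integral_measure_pmf_real[where A=UNIV] pmf_policy_pmf[OF assms] mult.commute)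
  finally show ?thesis .
qed

lemma state_pmf_vec:
  fixes M :: "('s::finite, 'a::finite) mdp"
  assumes "\<pi> \<in> policies"
  shows "((\<lambda>v. v v* policy_trans M \<pi>) ^^ t) (axis s 1) = (\<chi> s'. pmf (state_pmf M \<pi> s t) s')"
proof (induction t)
  case 0
  show ?case by (simp add: vec_eq_iff axis_def pmf_return indicator_def)
next
  case (Suc t)
  have "pmf (state_pmf M \<pi> s (Suc t)) s'
      = (\<Sum>u\<in>UNIV. pmf (state_pmf M \<pi> s t) u * (\<Sum>a\<in>UNIV. \<pi> $ u $ a * pmf (trans M u a) s'))" for s'
    by (simp add: pmf_bind expectation_state_action_pmf[OF assms])
  with Suc.IH show ?case
    by (simp add: vec_eq_iff vector_matrix_mult_def policy_trans_def)
qed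

lemma state_value_sums:
  fixes M :: "('s::finite, 'a::finite) mdp"
  assumes M: "finite_mdp M" and \<pi>: "\<pi> \<in> policies"
  shows "(\<lambda>t. disc M ^ t * ((((\<lambda>v. v v* policy_trans M \<pi>) ^^ t) (axis s 1)) \<bullet> policy_reward M \<pi>))
    sums state_value M \<pi> s"
proof -
  interpret IT: Ionescu_Tulcea "step_kernel M \<pi> s" "\<lambda>_. count_space (UNIV :: ('s \<times> 'a) set)"
    by (rule Ionescu_Tulcea_step_kernel)
  let ?T = "trajectory M \<pi> s" and ?r = "\<lambda>x. reward M (fst x) (snd x)"
  have tr: "trajectory M \<pi> s = IT.PF.lim" by (simp add: trajectory_def)
  interpret T: prob_space ?T
    unfolding tr
    by (rule prob_space_distrD[where f="\<lambda>h. restrict h {}" and N="PiM {} (\<lambda>_. count_space UNIV)"])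
      (auto simp: IT.distr_lim IT.PF.prob_space_P measurable_cong_sets[OF IT.PF.sets_lim refl]
        intro!: measurable_restrict_subset)
  have co: "(\<lambda>\<omega>. \<omega> t) \<in> measurable ?T (count_space UNIV)" for t
    unfolding tr by (subst measurable_cong_sets[OF IT.PF.sets_lim refl]) (rule measurable_component_singleton, simp)
  have meas: "(\<lambda>\<omega>. ?r (\<omega> t)) \<in> borel_measurable ?T" for t
    by (rule measurable_compose[OF co]) simp
  define B where "B = (\<Sum>x\<in>UNIV. \<bar>?r x\<bar>)"
  have B: "\<bar>?r x\<bar> \<le> B" for x
    unfolding B_def by (rule member_le_sum) auto
  have d: "0 \<le> disc M" "disc M < 1" using M by (auto simp: finite_mdp_def)
  have intg: "integrable ?T (\<lambda>\<omega>. disc M ^ t * ?r (\<omega> t))" for t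
    by (rule T.integrable_const_bound[where B="disc M ^ t * B"])
      (use d B meas in \<open>auto simp: abs_mult intro!: mult_left_mono borel_measurable_times\<close>)
  have sumB: "summable (\<lambda>t. disc M ^ t * B)"
    using d by (intro summable_mult2 summable_geometric) auto
  have "(\<lambda>t. \<integral>\<omega>. disc M ^ t * ?r (\<omega> t) \<partial>?T) sums (\<integral>\<omega>. (\<Sum>t. disc M ^ t * ?r (\<omega> t)) \<partial>?T)"
  proof (rule sums_integral[OF intg])
    show "AE \<omega> in ?T. summable (\<lambda>t. norm (disc M ^ t * ?r (\<omega> t)))"
      by (rule AE_I2, rule summable_comparison_test'[OF sumB])
        (use d B in \<open>auto simp: abs_mult intro!: mult_left_mono\<close>)
    show "summable (\<lambda>t. \<integral>\<omega>. norm (disc M ^ t * ?r (\<omega> t)) \<partial>?T)"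
    proof (rule summable_comparison_test'[OF sumB])
      fix t :: nat
      have "(\<integral>\<omega>. norm (disc M ^ t * ?r (\<omega> t)) \<partial>?T) \<le> (\<integral>\<omega>. disc M ^ t * B \<partial>?T)"
        by (rule integral_mono)
          (use d B in \<open>auto simp: abs_mult intro!: mult_left_mono integrable_norm[OF intg] simp del: real_norm_def\<close>,
           use d B in \<open>auto simp: abs_mult intro!: mult_left_mono\<close>)
      then show "norm (\<integral>\<omega>. norm (disc M ^ t * ?r (\<omega> t)) \<partial>?T) \<le> disc M ^ t * B"
        by (simp add: T.prob_space)
    qed
  qed
  moreover have "(\<integral>\<omega>. disc M ^ t * ?r (\<omega> t) \<partial>?T)
      = disc M ^ t * ((((\<lambda>v. v v* policy_trans M \<pi>) ^^ t) (axis s 1)) \<bullet> policy_reward M \<pi>)" for t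
  proof -
    have "(\<integral>\<omega>. ?r (\<omega> t) \<partial>?T) = (\<integral>x. ?r x \<partial>distr ?T (count_space UNIV) (\<lambda>\<omega>. \<omega> t))"
      by (subst integral_distr[OF co]) auto
    also have "\<dots> = (((\<lambda>v. v v* policy_trans M \<pi>) ^^ t) (axis s 1)) \<bullet> policy_reward M \<pi>"
      by (simp add: distr_trajectory_coordinate expectation_state_action_pmf[OF \<pi>] state_pmf_vec[OF \<pi>]
          inner_vec_def policy_reward_def)
    finally show ?thesis by simp
  qed
  ultimately show ?thesis by (simp only: state_value_def)
qed

lemma objective_eq_ext:
  fixes M :: "('s::finite, 'a::finite) mdp"
  assumes M: "finite_mdp M" and \<pi>: "\<pi> \<in> policies"
  shows "objective M \<pi> = objective_ext M \<pi>"
proof -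
  let ?P = "policy_trans M \<pi>"
  let ?A = "mat 1 - disc M *\<^sub>R ?P"
  have d: "0 \<le> disc M" "disc M < 1" using M by (auto simp: finite_mdp_def)
  define p where "p s t = disc M ^ t *\<^sub>R ((\<lambda>v. v v* ?P) ^^ t) (axis s 1)" for s t
  have "norm (((\<lambda>v. v v* ?P) ^^ t) (axis s 1)) \<le> 1" for s t
    unfolding state_pmf_vec[OF \<pi>]
    by (rule order_trans[OF norm_le_l1_cart]) (simp add: sum_pmf_eq_1)
  then have nb: "norm (p s t) \<le> disc M ^ t" for s t
    using d by (simp add: p_def mult_left_le)
  have summ: "summable (p s)" for s
    by (rule summable_comparison_test'[OF summable_geometric nb]) (use d in auto)
  define X where "X = (\<chi> s. \<Sum>t. p s t)"
  have bl: "bounded_linear (\<lambda>v. v v* ?P)"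
    by (simp add: linear_conv_bounded_linear[symmetric] linear_iff vector_matrix_left_distrib scaleR_vector_matrix_assoc)
  have row: "X $ s v* ?A = axis s 1" for s
  proof -
    have "disc M *\<^sub>R (X $ s v* ?P) = (\<Sum>t. disc M *\<^sub>R (p s t v* ?P))"
      by (simp add: X_def bounded_linear.suminf[OF bl summ] suminf_scaleR_right bounded_linear.summable[OF bl summ])
    also have "\<dots> = (\<Sum>t. p s (Suc t))"
      by (simp add: p_def scaleR_vector_matrix_assoc)
    also have "\<dots> = X $ s - p s 0"
      using suminf_split_head[OF summ, of s] by (simp add: X_def)
    finally show ?thesis
      by (simp add: vector_matrix_mult_diff_rdistrib vector_scaleR_matrix_ac scaleR_vector_matrix_assoc p_def)
  qed
  have XA: "X ** ?A = mat 1"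
  proof -
    have "(X ** ?A) $ s = X $ s v* ?A" for s
      by (simp add: vec_eq_iff matrix_matrix_mult_def vector_matrix_mult_def)
    moreover have "axis s 1 = (mat 1 :: real ^ 's ^ 's) $ s" for s
      by (auto simp: vec_eq_iff mat_def axis_def)
    ultimately show ?thesis by (metis row vec_eq_iff)
  qed
  have AX: "?A ** X = mat 1"
    by (rule matrix_left_right_inverse[THEN iffD1, OF XA])
  have "?A ** matrix_inv ?A = mat 1 \<and> matrix_inv ?A ** ?A = mat 1"
    unfolding matrix_inv_def by (rule someI[of _ X], rule conjI[OF AX XA])
  then have "X ** (?A ** matrix_inv ?A) = X" by simp
  then have inv: "matrix_inv ?A = X"
    by (simp only: matrix_mul_assoc XA matrix_mul_lid)
  have V: "state_value M \<pi> s = X $ s \<bullet> policy_reward M \<pi>" for s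
  proof -
    have "(\<lambda>t. p s t \<bullet> policy_reward M \<pi>) sums (X $ s \<bullet> policy_reward M \<pi>)"
      unfolding X_def by (simp add: bounded_linear.sums[OF bounded_linear_inner_left summable_sums[OF summ]])
    moreover have "(\<lambda>t. p s t \<bullet> policy_reward M \<pi>) sums state_value M \<pi> s"
      using state_value_sums[OF M \<pi>, of s] by (simp add: p_def)
    ultimately show ?thesis by (rule sums_unique2[symmetric])
  qed
  have "init_vec M v* X = (\<Sum>s\<in>UNIV. pmf (init M) s *\<^sub>R X $ s)"
    by (simp add: vec_eq_iff vector_matrix_mult_def init_vec_def)
  then have "(init_vec M v* X) \<bullet> policy_reward M \<pi>
     = (\<Sum>s\<in>UNIV. pmf (init M) s * state_value M \<pi> s)"
    by (simp add: inner_sum_left V)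
  then show ?thesis by (simp add: objective_def objective_ext_def inv)
qed


definition grad_objective :: "('s::finite, 'a::finite) mdp \<Rightarrow> real ^ 'a ^ 's \<Rightarrow> real ^ 'a ^ 's" where
  "grad_objective M \<pi> = (THE D. GDERIV (objective_ext M) \<pi> :> D)"

definition occupancy :: "('s::finite, 'a::finite) mdp \<Rightarrow> real ^ 'a ^ 's \<Rightarrow> real ^ 's" where
  "occupancy M \<pi> = (1 - disc M) *\<^sub>R
     (\<Sum>t. disc M ^ t *\<^sub>R ((\<lambda>v. v v* policy_trans M \<pi>) ^^ t) (init_vec M))"


definition agg_policies :: "('s::finite \<Rightarrow> nat) \<Rightarrow> (real ^ 'a::finite ^ 's) set" where
  "agg_policies \<phi> = {\<pi> \<in> policies. \<forall>s s'. \<phi> s = \<phi> s' \<longrightarrow> \<pi> $ s = \<pi> $ s'}"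

definition agg_values :: "('s::finite \<Rightarrow> nat) \<Rightarrow> (real ^ 'a::finite ^ 's) set" where
  "agg_values \<phi> = {Q. \<forall>s s'. \<phi> s = \<phi> s' \<longrightarrow> (\<forall>a. Q $ s $ a = Q $ s' $ a)}"

definition weighted_norm :: "real ^ 's::finite \<Rightarrow> real ^ 'a::finite ^ 's \<Rightarrow> real" where
  "weighted_norm w Q = sqrt (\<Sum>s\<in>UNIV. \<Sum>a\<in>UNIV. w $ s * (Q $ s $ a)\<^sup>2)"

definition is_fw_direction :: "('s::finite, 'a::finite) mdp \<Rightarrow> ('s \<Rightarrow> nat)
    \<Rightarrow> real ^ 'a ^ 's \<Rightarrow> real ^ 'a ^ 's \<Rightarrow> bool" where
  "is_fw_direction M \<phi> \<pi> =
     is_arg_max (\<lambda>\<mu>. grad_objective M \<pi> \<bullet> (\<mu> - \<pi>)) (\<lambda>\<mu>. \<mu> \<in> agg_policies \<phi>)"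

(* In both runs the iterates are indexed by t \<ge> 1 and the intermediate maximizers by t \<ge> 2;
   other entries of the sequences are irrelevant. *)
definition frank_wolfe_run :: "('s::finite, 'a::finite) mdp \<Rightarrow> real \<Rightarrow> real ^ 'a ^ 's
    \<Rightarrow> ('s \<Rightarrow> nat) \<Rightarrow> (nat \<Rightarrow> real ^ 'a ^ 's) \<Rightarrow> (nat \<Rightarrow> real ^ 'a ^ 's) \<Rightarrow> bool" where
  "frank_wolfe_run M \<alpha> \<pi>\<^sub>1 \<phi> \<pi> \<mu> \<longleftrightarrow> \<pi> 1 = \<pi>\<^sub>1 \<and>
     (\<forall>t\<ge>1. is_fw_direction M \<phi> (\<pi> t) (\<mu> (t + 1)) \<and>
             \<pi> (t + 1) = \<alpha> *\<^sub>R \<mu> (t + 1) + (1 - \<alpha>) *\<^sub>R \<pi> t)"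

definition is_greedy_action :: "real ^ 'a::finite ^ 's::finite \<Rightarrow> 's \<Rightarrow> 'a \<Rightarrow> bool" where
  "is_greedy_action Q s = is_arg_max (\<lambda>a. Q $ s $ a) (\<lambda>_. True)"

definition det_policy :: "('s::finite \<Rightarrow> 'a::finite) \<Rightarrow> real ^ 'a ^ 's" where
  "det_policy g = (\<chi> s. axis (g s) 1)"

definition soft_api_run :: "('s::finite, 'a::finite) mdp \<Rightarrow> real \<Rightarrow> real ^ 'a ^ 's
    \<Rightarrow> ('s \<Rightarrow> nat) \<Rightarrow> (nat \<Rightarrow> real ^ 'a ^ 's) \<Rightarrow> (nat \<Rightarrow> real ^ 'a ^ 's) \<Rightarrow> (nat \<Rightarrow> 's \<Rightarrow> 'a) \<Rightarrow> bool" where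
  "soft_api_run M \<alpha> \<pi>\<^sub>1 \<phi> \<pi> Q g \<longleftrightarrow> \<pi> 1 = \<pi>\<^sub>1 \<and>
     (\<forall>t\<ge>1. is_arg_min (\<lambda>Q'. weighted_norm (occupancy M (\<pi> t)) (Q' - action_value M (\<pi> t)))
                 (\<lambda>Q'. Q' \<in> agg_values \<phi>) (Q t) \<and>
             (\<forall>s. is_greedy_action (Q t) s (g (t + 1) s)) \<and>
             \<pi> (t + 1) = \<alpha> *\<^sub>R det_policy (g (t + 1)) + (1 - \<alpha>) *\<^sub>R \<pi> t)"

end

theory Submission
  imports Defs
begin

text \<open>
  By the policy gradient theorem \<open>\<nabla>J(\<pi>)(s,a) = \<eta>\<^sub>\<pi>(s) Q\<^sub>\<pi>(s,a)\<close>, so the Frank-Wolfe objective at \<open>\<mu>\<close> is,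
  up to a constant, the \<open>\<eta>\<^sub>\<pi>\<close>-weighted inner product of \<open>Q\<^sub>\<pi>\<close> with \<open>\<mu>\<close>. Aggregated policies lie in the
  subspace onto which soft API projects orthogonally for that same inner product, so \<open>Q\<^sub>\<pi>\<close> may be replaced
  by its projection there. A linear functional of this kind is maximized by acting greedily in every
  state, and the greedy policy is itself aggregated because the greedy actions are unique.
\<close>

section \<open>Derivatives and inverse matrices\<close>

text \<open>Caratheodory's form of differentiability: the remainder is
  \<open>(G y - G x) \<bullet> (y - x)\<close>, which Cauchy-Schwarz makes
  o(\<open>norm (y - x)\<close>). With it the matrix inverse in \<open>objective_ext\<close> has to
  be continuous only and is never differentiated.\<close>

lemma gderiv_caratheodoryI:
  fixes f :: "'a::euclidean_space \<Rightarrow> real" and G :: "'a \<Rightarrow> 'a"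
  assumes ev: "eventually (\<lambda>y. f y - f x = G y \<bullet> (y - x)) (at x)"
    and G: "(G \<longlongrightarrow> G x) (at x)"
  shows "GDERIV f x :> G x"
  unfolding gderiv_def has_derivative_iff_norm
proof
  show "bounded_linear (\<lambda>h. h \<bullet> G x)" by (rule bounded_linear_inner_left)
  have lim: "((\<lambda>y. norm (G y - G x)) \<longlongrightarrow> 0) (at x)"
    using G by (simp add: LIM_zero tendsto_norm_zero)
  show "((\<lambda>y. norm (f y - f x - (y - x) \<bullet> G x) / norm (y - x)) \<longlongrightarrow> 0) (at x)"
  proof (rule Lim_null_comparison[OF _ lim])
    show "eventually (\<lambda>y. norm (norm (f y - f x - (y - x) \<bullet> G x) / norm (y - x)) \<le> norm (G y - G x)) (at x)"
      using ev
    proof eventually_elim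
      case (elim y)
      have "f y - f x - (y - x) \<bullet> G x = (G y - G x) \<bullet> (y - x)"
        by (simp add: elim inner_diff_left inner_diff_right inner_commute)
      then have "\<bar>f y - f x - (y - x) \<bullet> G x\<bar> \<le> norm (G y - G x) * norm (y - x)"
        by (metis Cauchy_Schwarz_ineq2)
      then show ?case
        by (cases "y = x") (auto simp: divide_le_eq)
    qed
  qed
qed

lemma gderiv_unique:
  fixes f :: "'a::euclidean_space \<Rightarrow> real"
  assumes "GDERIV f x :> D" and "GDERIV f x :> E"
  shows "D = E"
proof -
  have "(\<lambda>h. h \<bullet> D) = (\<lambda>h. h \<bullet> E)"
    using assms unfolding gderiv_def by (rule has_derivative_unique)
  then show ?thesis
    by (metis inner_commute vector_eq_rdot)
qed

lemma matrix_inv_right_left: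
  fixes A :: "real ^ 'n ^ 'n"
  assumes "invertible A"
  shows "A ** matrix_inv A = mat 1" and "matrix_inv A ** A = mat 1"
proof -
  have "A ** matrix_inv A = mat 1 \<and> matrix_inv A ** A = mat 1"
    using assms unfolding invertible_def matrix_inv_def by (rule someI_ex)
  then show "A ** matrix_inv A = mat 1" and "matrix_inv A ** A = mat 1" by auto
qed

lemma tendsto_det [tendsto_intros]:
  fixes A :: "'b \<Rightarrow> real ^ 'n ^ 'n"
  assumes "(A \<longlongrightarrow> L) F"
  shows "((\<lambda>x. det (A x)) \<longlongrightarrow> det L) F"
  unfolding det_def by (intro tendsto_intros assms)

lemma eventually_invertible:
  fixes A :: "'b \<Rightarrow> real ^ 'n ^ 'n"
  assumes "(A \<longlongrightarrow> L) F" and "invertible L"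
  shows "eventually (\<lambda>x. invertible (A x)) F"
  using tendsto_imp_eventually_ne[OF tendsto_det[OF assms(1)]] assms(2)
  by (simp add: invertible_det_nz)

text \<open>Cramer's rule writes the solution of a regular system as a rational function of its entries.\<close>

lemma tendsto_vector_matrix_inv:
  fixes A :: "'b \<Rightarrow> real ^ 'n ^ 'n"
  assumes A: "(A \<longlongrightarrow> L) F" and L: "invertible L"
  shows "((\<lambda>x. v v* matrix_inv (A x)) \<longlongrightarrow> v v* matrix_inv L) F"
proof -
  \<comment> \<open>\<open>cramer\<close> solves column systems, so the row equation
    \<open>x v* B = v\<close> is transposed; \<open>C\<close> puts \<open>v\<close> in place of
    column \<open>k\<close>.\<close>
  define C where "C B = (\<chi> k. det (\<chi> i j. if j = k then v $ i else transpose B $ i $ j) / det B)"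
    for B :: "real ^ 'n ^ 'n"
  have C: "v v* matrix_inv B = C B" if "invertible B" for B
  proof -
    have "transpose B *v (v v* matrix_inv B) = v"
      using that by (simp add: vector_matrix_mul_assoc matrix_inv_right_left)
    moreover have "det (transpose B) \<noteq> 0"
      using that by (simp add: invertible_det_nz)
    ultimately show ?thesis
      using cramer[of "transpose B" "v v* matrix_inv B" v] by (simp add: C_def)
  qed
  have "((\<lambda>x. C (A x)) \<longlongrightarrow> C L) F"
    unfolding C_def
  proof (intro tendsto_intros A)
    fix k i j
    show "((\<lambda>x. if j = k then v $ i else transpose (A x) $ i $ j)
        \<longlongrightarrow> (if j = k then v $ i else transpose L $ i $ j)) F"
      by (auto simp: transpose_def intro!: tendsto_intros A)
  qed (use L in \<open>simp add: invertible_det_nz\<close>)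
  moreover have "eventually (\<lambda>x. C (A x) = v v* matrix_inv (A x)) F"
    using eventually_invertible[OF A L] by eventually_elim (simp add: C)
  ultimately show ?thesis
    using C[OF L] by (simp add: tendsto_cong)
qed

text \<open>The shifted series sums both to \<open>L X\<close> and to \<open>X - x 0\<close>. This
  turns the discounted series for values and for occupancies into linear equations.\<close>

lemma sums_linear_recurrence:
  assumes "bounded_linear L" and "\<And>n. x (Suc n) = L (x n)" and "x sums X"
  shows "X - L X = x 0"
proof -
  have "(\<lambda>n. x (Suc n)) sums L X"
    using bounded_linear.sums[OF assms(1,3)] by (simp add: assms(2))
  moreover have "(\<lambda>n. x (Suc n)) sums (X - x 0)"
    using assms(3) by (simp add: sums_Suc_iff)
  ultimately show ?thesis
    by (metis sums_unique2 diff_diff_eq2 add_diff_cancel_left' diff_add_cancel)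
qed

section \<open>The policy gradient\<close>

text \<open>The matrix inverted in \<open>objective_ext\<close>. State values solve a system with it
  acting on columns, occupancies one with it acting on rows.\<close>

definition bellman_matrix :: "('s::finite, 'a::finite) mdp \<Rightarrow> real ^ 'a ^ 's \<Rightarrow> real ^ 's ^ 's" where
  "bellman_matrix M \<pi> = mat 1 - disc M *\<^sub>R policy_trans M \<pi>"

lemma policy_trans_nonneg:
  "\<pi> \<in> policies \<Longrightarrow> 0 \<le> policy_trans M \<pi> $ s $ s'"
  by (simp add: policy_trans_def policies_def sum_nonneg)

lemma policy_trans_row_sum:
  fixes M :: "('s::finite, 'a::finite) mdp"
  assumes "\<pi> \<in> policies"
  shows "(\<Sum>s'\<in>UNIV. policy_trans M \<pi> $ s $ s') = 1"
proof -
  have "(\<Sum>s'\<in>UNIV. policy_trans M \<pi> $ s $ s')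
      = (\<Sum>a\<in>UNIV. \<pi> $ s $ a * (\<Sum>s'\<in>UNIV. pmf (trans M s a) s'))"
    by (simp add: policy_trans_def sum_distrib_left) (rule sum.swap)
  then show ?thesis
    using assms by (simp add: sum_pmf_eq_1 policies_def)
qed

text \<open>A maximum principle: a kernel vector satisfies
  \<open>x = disc M *\<^sub>R (P *v x)\<close>. Where its absolute value is largest, averaging over
  a row of \<open>P\<close> cannot increase it, so the discount forces it to be zero.\<close>

lemma invertible_bellman_matrix:
  fixes M :: "('s::finite, 'a::finite) mdp"
  assumes M: "finite_mdp M" and \<pi>: "\<pi> \<in> policies"
  shows "invertible (bellman_matrix M \<pi>)"
proof -
  let ?P = "policy_trans M \<pi>"
  have d: "0 \<le> disc M" "disc M < 1" using M by (auto simp: finite_mdp_def)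
  have "x = 0" if x: "bellman_matrix M \<pi> *v x = 0" for x :: "real ^ 's"
  proof -
    have fix_x: "x = disc M *\<^sub>R (?P *v x)"
      using x by (simp add: bellman_matrix_def matrix_vector_mult_diff_rdistrib scaleR_matrix_vector_assoc)
    obtain s where s: "\<bar>x $ s\<bar> = Max (range (\<lambda>s. \<bar>x $ s\<bar>))"
      using Max_in[of "range (\<lambda>s. \<bar>x $ s\<bar>)"] by fastforce
    have le: "\<bar>x $ s'\<bar> \<le> \<bar>x $ s\<bar>" for s'
      unfolding s by (rule Max_ge) auto
    have "\<bar>(?P *v x) $ s\<bar> \<le> (\<Sum>s'\<in>UNIV. ?P $ s $ s' * \<bar>x $ s'\<bar>)"
      unfolding matrix_vector_mult_def vec_lambda_beta
      by (rule order_trans[OF sum_abs]) (simp add: abs_mult policy_trans_nonneg[OF \<pi>])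
    also have "\<dots> \<le> (\<Sum>s'\<in>UNIV. ?P $ s $ s' * \<bar>x $ s\<bar>)"
      by (intro sum_mono mult_left_mono le policy_trans_nonneg[OF \<pi>])
    also have "\<dots> = \<bar>x $ s\<bar>"
      by (simp add: sum_distrib_right[symmetric] policy_trans_row_sum[OF \<pi>])
    finally have "\<bar>x $ s\<bar> \<le> disc M * \<bar>x $ s\<bar>"
      using d(1) by (subst (1) fix_x) (simp add: abs_mult mult_left_mono)
    then have "\<bar>x $ s\<bar> = 0"
      using d mult_strict_right_mono[of "disc M" 1 "\<bar>x $ s\<bar>"] by linarith
    then show ?thesis
      using le by (simp add: vec_eq_iff)
  qed
  then obtain B where "B ** bellman_matrix M \<pi> = mat 1"
    using matrix_left_invertible_ker by blast
  then show ?thesis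
    using matrix_left_right_inverse unfolding invertible_def by blast
qed

lemma bellman_equation:
  fixes M :: "('s::finite, 'a::finite) mdp"
  assumes M: "finite_mdp M" and \<pi>: "\<pi> \<in> policies"
  shows "bellman_matrix M \<pi> *v (\<chi> s. state_value M \<pi> s) = policy_reward M \<pi>"
proof -
  let ?P = "policy_trans M \<pi>"
  define x where "x t = disc M ^ t *\<^sub>R (((\<lambda>v. ?P *v v) ^^ t) (policy_reward M \<pi>))" for t
  \<comment> \<open>\<open>state_value_sums\<close> pushes the point mass at \<open>s\<close>
    forward; moving the powers across the inner product leaves coordinate \<open>s\<close> of one
    column series common to all states.\<close>
  have adjoint: "(((\<lambda>v. v v* ?P) ^^ t) u) \<bullet> r = u \<bullet> (((\<lambda>v. ?P *v v) ^^ t) r)" for t u r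
    by (induction t arbitrary: u) (simp_all add: funpow_Suc_right dot_lmul_matrix[symmetric] del: funpow.simps(2),
      simp add: funpow_swap1 dot_lmul_matrix)
  have "x sums (\<chi> s. state_value M \<pi> s)"
    unfolding sums_def
  proof (rule vec_tendstoI)
    fix s
    show "((\<lambda>n. (\<Sum>t<n. x t) $ s) \<longlongrightarrow> (\<chi> s. state_value M \<pi> s) $ s) sequentially"
      using state_value_sums[OF M \<pi>, of s]
      by (simp add: sums_def adjoint x_def inner_axis' sum_component)
  qed
  moreover have "bounded_linear (\<lambda>v. disc M *\<^sub>R (?P *v v))"
    by (intro bounded_linear_scaleR_right[THEN bounded_linear_compose] matrix_vector_mul_bounded_linear)
  moreover have "x (Suc t) = disc M *\<^sub>R (?P *v x t)" for t
    by (simp add: x_def matrix_vector_mult_scaleR)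
  ultimately show ?thesis
    using sums_linear_recurrence[of "\<lambda>v. disc M *\<^sub>R (?P *v v)" x]
    by (simp add: bellman_matrix_def matrix_vector_mult_diff_rdistrib scaleR_matrix_vector_assoc x_def)
qed

text \<open>Each iterate of \<open>init_vec M\<close> is again a probability vector, hence of norm
  at most 1, and the geometric series dominates.\<close>

lemma
  fixes M :: "('s::finite, 'a::finite) mdp"
  assumes M: "finite_mdp M" and \<pi>: "\<pi> \<in> policies"
  shows occupancy_sums: "(\<lambda>t. disc M ^ t *\<^sub>R ((\<lambda>v. v v* policy_trans M \<pi>) ^^ t) (init_vec M))
      sums ((1 / (1 - disc M)) *\<^sub>R occupancy M \<pi>)"
    and occupancy_nonneg: "0 \<le> occupancy M \<pi> $ s"
proof -
  let ?P = "policy_trans M \<pi>"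
  let ?v = "\<lambda>t. ((\<lambda>v. v v* ?P) ^^ t) (init_vec M)"
  have d: "0 \<le> disc M" "disc M < 1" using M by (auto simp: finite_mdp_def)
  have v: "(\<forall>s. 0 \<le> ?v t $ s) \<and> (\<Sum>s\<in>UNIV. ?v t $ s) = 1" for t
  proof (induction t)
    case 0
    show ?case by (simp add: init_vec_def sum_pmf_eq_1)
  next
    case (Suc t)
    have "(\<Sum>s\<in>UNIV. ?v (Suc t) $ s) = (\<Sum>u\<in>UNIV. ?v t $ u * (\<Sum>s\<in>UNIV. ?P $ u $ s))"
      unfolding sum_distrib_left by (subst sum.swap) (simp add: vector_matrix_mult_def mult.commute)
    with Suc show ?case
      by (simp add: policy_trans_row_sum[OF \<pi>])
        (simp add: vector_matrix_mult_def sum_nonneg policy_trans_nonneg[OF \<pi>])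
  qed
  have "norm (?v t) \<le> 1" for t
    using v[of t] by (intro order_trans[OF norm_le_l1_cart]) simp
  then have "norm (disc M ^ t *\<^sub>R ?v t) \<le> disc M ^ t" for t
    using d by (simp add: mult_left_le)
  then have summ: "summable (\<lambda>t. disc M ^ t *\<^sub>R ?v t)"
    using d by (intro summable_comparison_test'[OF summable_geometric]) auto
  then show "(\<lambda>t. disc M ^ t *\<^sub>R ?v t) sums ((1 / (1 - disc M)) *\<^sub>R occupancy M \<pi>)"
    using d by (simp add: occupancy_def summable_sums)
  have "0 \<le> (\<Sum>t. (disc M ^ t *\<^sub>R ?v t) $ s)"
    using d v bounded_linear.summable[OF bounded_linear_vec_nth summ]
    by (intro suminf_nonneg) auto
  then show "0 \<le> occupancy M \<pi> $ s"
    using d by (simp add: occupancy_def bounded_linear.suminf[OF bounded_linear_vec_nth summ])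
qed

lemma occupancy_eq_matrix_inv:
  fixes M :: "('s::finite, 'a::finite) mdp"
  assumes M: "finite_mdp M" and \<pi>: "\<pi> \<in> policies"
  shows "occupancy M \<pi> = (1 - disc M) *\<^sub>R (init_vec M v* matrix_inv (bellman_matrix M \<pi>))"
proof -
  let ?P = "policy_trans M \<pi>" and ?A = "bellman_matrix M \<pi>"
  define X where "X = (1 / (1 - disc M)) *\<^sub>R occupancy M \<pi>"
  have d: "disc M < 1" using M by (auto simp: finite_mdp_def)
  have "bounded_linear (\<lambda>v. disc M *\<^sub>R (v v* ?P))"
    by (simp add: linear_conv_bounded_linear[symmetric] linear_iff vector_matrix_left_distrib
        scaleR_vector_matrix_assoc scaleR_add_right scaleR_left_commute)
  then have "X - disc M *\<^sub>R (X v* ?P) = init_vec M"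
    using sums_linear_recurrence[OF _ _ occupancy_sums[OF M \<pi>], of "\<lambda>v. disc M *\<^sub>R (v v* ?P)"]
    by (simp add: X_def scaleR_vector_matrix_assoc)
  then have "X v* ?A = init_vec M"
    by (simp add: bellman_matrix_def vector_matrix_mult_diff_rdistrib vector_scaleR_matrix_ac
        scaleR_vector_matrix_assoc)
  then have "init_vec M v* matrix_inv ?A = X v* (?A ** matrix_inv ?A)"
    by (simp add: vector_matrix_mul_assoc[symmetric])
  then show ?thesis
    using d by (simp add: matrix_inv_right_left invertible_bellman_matrix[OF M \<pi>] X_def)
qed

lemma tendsto_bellman_matrix:
  "(bellman_matrix M \<longlongrightarrow> bellman_matrix M \<pi>) (at \<pi>)"
  unfolding bellman_matrix_def[abs_def] policy_trans_def by (intro tendsto_intros)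

text \<open>An exact performance difference identity, valid for every \<open>y\<close> with
  invertible Bellman matrix, whether or not \<open>y\<close> is a policy, is fed into Caratheodory's
  criterion.\<close>

lemma policy_gradient_theorem:
  fixes M :: "('s::finite, 'a::finite) mdp"
  assumes M: "finite_mdp M" and \<pi>: "\<pi> \<in> policies"
  shows "grad_objective M \<pi> = (\<chi> s a. occupancy M \<pi> $ s * action_value M \<pi> $ s $ a)"
proof -
  \<comment> \<open>\<open>w\<close> continues the occupancy measure off the policies. In
    \<open>G\<close> only this weight moves with \<open>y\<close>; the action values stay those of
    \<open>\<pi>\<close>.\<close>
  define w where "w y = (1 - disc M) *\<^sub>R (init_vec M v* matrix_inv (bellman_matrix M y))" for y
  define G where "G y = (\<chi> s a. w y $ s * action_value M \<pi> $ s $ a)" for y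
  define V where "V = (\<chi> s. state_value M \<pi> s)"
  note inv = invertible_bellman_matrix[OF M \<pi>]
  have obj: "objective_ext M y = w y \<bullet> policy_reward M y" for y
    by (simp add: objective_ext_def w_def bellman_matrix_def)
  \<comment> \<open>The Bellman residual of the fixed vector \<open>V\<close> under \<open>y\<close>
    is affine in \<open>y\<close> and vanishes at \<open>\<pi>\<close>, so only
    \<open>y - \<pi>\<close> survives.\<close>
  have residual: "policy_reward M y - bellman_matrix M y *v V
      = (\<chi> s. \<Sum>a\<in>UNIV. (y - \<pi>) $ s $ a * action_value M \<pi> $ s $ a)" for y
  proof -
    have lin: "policy_reward M y + disc M *\<^sub>R (policy_trans M y *v V)
      = (\<chi> s. \<Sum>a\<in>UNIV. y $ s $ a * action_value M \<pi> $ s $ a)" for y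
    proof -
      have "(\<Sum>s'\<in>UNIV. (\<Sum>a\<in>UNIV. y $ s $ a * pmf (trans M s a) s') * V $ s')
          = (\<Sum>a\<in>UNIV. y $ s $ a * (\<Sum>s'\<in>UNIV. pmf (trans M s a) s' * V $ s'))" for s
        by (simp add: sum_distrib_left sum_distrib_right mult.assoc) (rule sum.swap)
      then show ?thesis
        by (simp add: vec_eq_iff policy_reward_def policy_trans_def matrix_vector_mult_def
            action_value_def V_def distrib_left sum.distrib sum_distrib_left mult.left_commute)
    qed
    have res: "policy_reward M y - bellman_matrix M y *v V
        = policy_reward M y + disc M *\<^sub>R (policy_trans M y *v V) - V" for y
      by (simp add: bellman_matrix_def matrix_vector_mult_diff_rdistrib scaleR_matrix_vector_assoc)
    have "policy_reward M \<pi> - bellman_matrix M \<pi> *v V = 0"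
      using bellman_equation[OF M \<pi>] by (simp add: V_def)
    then have "V = (\<chi> s. \<Sum>a\<in>UNIV. \<pi> $ s $ a * action_value M \<pi> $ s $ a)"
      unfolding res lin by simp
    then show ?thesis
      unfolding res lin by (simp add: vec_eq_iff left_diff_distrib sum_subtractf)
  qed
  \<comment> \<open>The inverse inside \<open>w y\<close> cancels the matrix, so this term does not
    depend on \<open>y\<close> and drops out of the difference of objectives.\<close>
  have wA: "w y \<bullet> (bellman_matrix M y *v V) = (1 - disc M) * (init_vec M \<bullet> V)"
    if "invertible (bellman_matrix M y)" for y
    using that by (simp add: w_def dot_lmul_matrix[symmetric] scaleR_vector_matrix_assoc[symmetric]
        vector_matrix_mul_assoc matrix_inv_right_left)
  have diff: "objective_ext M y - objective_ext M \<pi> = G y \<bullet> (y - \<pi>)"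
    if y: "invertible (bellman_matrix M y)" for y
  proof -
    have "objective_ext M \<pi> = (1 - disc M) * (init_vec M \<bullet> V)"
      using bellman_equation[OF M \<pi>] wA[OF inv] by (simp add: obj V_def)
    then have "objective_ext M y - objective_ext M \<pi> = w y \<bullet> (policy_reward M y - bellman_matrix M y *v V)"
      by (simp add: obj inner_diff_right wA[OF y])
    also have "\<dots> = G y \<bullet> (y - \<pi>)"
      unfolding residual by (simp add: G_def inner_vec_def sum_distrib_left mult_ac)
    finally show ?thesis .
  qed
  have "(w \<longlongrightarrow> w \<pi>) (at \<pi>)"
    unfolding w_def[abs_def] by (intro tendsto_intros tendsto_vector_matrix_inv tendsto_bellman_matrix inv)
  then have "(G \<longlongrightarrow> G \<pi>) (at \<pi>)"
    unfolding G_def[abs_def] by (intro tendsto_intros)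
  moreover have "eventually (\<lambda>y. objective_ext M y - objective_ext M \<pi> = G y \<bullet> (y - \<pi>)) (at \<pi>)"
    using eventually_invertible[OF tendsto_bellman_matrix inv] by eventually_elim (rule diff)
  ultimately have "GDERIV (objective_ext M) \<pi> :> G \<pi>"
    by (intro gderiv_caratheodoryI)
  then have "grad_objective M \<pi> = G \<pi>"
    unfolding grad_objective_def by (blast intro: gderiv_unique)
  then show ?thesis
    by (simp add: G_def w_def occupancy_eq_matrix_inv[OF M \<pi>])
qed

section \<open>Greedy improvement is a Frank-Wolfe step\<close>

text \<open>Since \<open>sqrt\<close> is extended oddly to negative numbers, minimizing \<open>weighted_norm w\<close> amounts to
  minimizing the quadratic form under the root even when \<open>w\<close> has negative entries.\<close>

lemma weighted_projection_orthogonal: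
  fixes q Q R :: "real ^ 'a::finite ^ 's::finite"
  assumes min: "is_arg_min (\<lambda>Q'. weighted_norm w (Q' - q)) (\<lambda>Q'. Q' \<in> agg_values \<phi>) Q"
    and R: "R \<in> agg_values \<phi>"
  shows "(\<Sum>s\<in>UNIV. \<Sum>a\<in>UNIV. w $ s * (Q $ s $ a * R $ s $ a))
    = (\<Sum>s\<in>UNIV. \<Sum>a\<in>UNIV. w $ s * (q $ s $ a * R $ s $ a))"
proof -
  define b where "b = (\<Sum>s\<in>UNIV. \<Sum>a\<in>UNIV. w $ s * ((Q - q) $ s $ a * R $ s $ a))"
  define c where "c = (\<Sum>s\<in>UNIV. \<Sum>a\<in>UNIV. w $ s * (R $ s $ a)\<^sup>2)"
  \<comment> \<open>First variation: moving from \<open>Q\<close> to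
    \<open>Q + e *\<^sub>R R\<close> stays among aggregated values and changes the quadratic form by
    this amount.\<close>
  have nonneg: "0 \<le> 2 * e * b + e\<^sup>2 * c" for e
  proof -
    have "Q \<in> agg_values \<phi>" using min by (simp add: is_arg_min_def)
    then have "Q + e *\<^sub>R R \<in> agg_values \<phi>"
      using R unfolding agg_values_def mem_Collect_eq vector_add_component vector_scaleR_component by metis
    then have "weighted_norm w (Q - q) \<le> weighted_norm w (Q + e *\<^sub>R R - q)"
      using min by (auto simp: is_arg_min_def not_less)
    then have "(\<Sum>s\<in>UNIV. \<Sum>a\<in>UNIV. w $ s * ((Q - q) $ s $ a)\<^sup>2)
        \<le> (\<Sum>s\<in>UNIV. \<Sum>a\<in>UNIV. w $ s * ((Q + e *\<^sub>R R - q) $ s $ a)\<^sup>2)"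
      unfolding weighted_norm_def real_sqrt_le_iff .
    also have "\<dots> = (\<Sum>s\<in>UNIV. \<Sum>a\<in>UNIV. w $ s * ((Q - q) $ s $ a)\<^sup>2
        + 2 * e * (w $ s * ((Q - q) $ s $ a * R $ s $ a)) + e\<^sup>2 * (w $ s * (R $ s $ a)\<^sup>2))"
      by (intro sum.cong refl) (simp add: power2_eq_square algebra_simps)
    also have "\<dots> = (\<Sum>s\<in>UNIV. \<Sum>a\<in>UNIV. w $ s * ((Q - q) $ s $ a)\<^sup>2) + 2 * e * b + e\<^sup>2 * c"
      unfolding b_def c_def sum.distrib sum_distrib_left ..
    finally show ?thesis by simp
  qed
  have "b = 0"
  proof (rule ccontr)
    assume "b \<noteq> 0"
    \<comment> \<open>A step against the sign of \<open>b\<close>; dividing by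
      \<open>\<bar>c\<bar> + 1\<close> is safe for every sign of \<open>c\<close> and lets the
      linear term dominate.\<close>
    define e where "e = - b / (\<bar>c\<bar> + 1)"
    have "2 * e * b + e\<^sup>2 * c = (b\<^sup>2 / (\<bar>c\<bar> + 1)\<^sup>2) * (c - 2 * (\<bar>c\<bar> + 1))"
    proof -
      have "\<bar>c\<bar> + 1 \<noteq> 0" by linarith
      then have "b = - e * (\<bar>c\<bar> + 1)" by (simp add: e_def)
      then show ?thesis
        using \<open>\<bar>c\<bar> + 1 \<noteq> 0\<close> by (simp add: power_mult_distrib) (simp add: power2_eq_square algebra_simps)
    qed
    moreover have "\<dots> < 0"
      using \<open>b \<noteq> 0\<close> by (intro mult_pos_neg) auto
    ultimately show False using nonneg[of e] by linarith
  qed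
  then show ?thesis
    by (simp add: b_def left_diff_distrib right_diff_distrib sum_subtractf)
qed

text \<open>States in one cell share a row of \<open>Q\<close>, hence the same greedy actions;
  uniqueness excludes breaking ties differently inside a cell.\<close>

lemma det_policy_in_agg_policies:
  assumes "Q \<in> agg_values \<phi>" and greedy: "\<And>s. is_greedy_action Q s (g s)"
    and unique: "\<And>s. \<exists>!a. is_greedy_action Q s a"
  shows "det_policy g \<in> agg_policies \<phi>"
proof -
  have "g s = g s'" if "\<phi> s = \<phi> s'" for s s'
  proof -
    have "is_greedy_action Q s = is_greedy_action Q s'"
    proof -
      have "(\<lambda>a. Q $ s $ a) = (\<lambda>a. Q $ s' $ a)"
        using assms(1) that unfolding agg_values_def by blast
      then show ?thesis unfolding is_greedy_action_def by (rule arg_cong)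
    qed
    then show ?thesis by (metis greedy unique)
  qed
  then have "\<forall>s s'. \<phi> s = \<phi> s' \<longrightarrow> det_policy g $ s = det_policy g $ s'"
    unfolding det_policy_def vec_lambda_beta by metis
  moreover have "det_policy g \<in> policies"
    by (simp add: policies_def det_policy_def axis_def)
  ultimately show ?thesis
    unfolding agg_policies_def by blast
qed

lemma greedy_ge_policy:
  assumes "\<mu> \<in> policies" and "is_greedy_action Q s (g s)"
  shows "(\<Sum>a\<in>UNIV. Q $ s $ a * \<mu> $ s $ a) \<le> (\<Sum>a\<in>UNIV. Q $ s $ a * det_policy g $ s $ a)"
proof -
  have "Q $ s $ a \<le> Q $ s $ g s" for a
    using assms(2) by (auto simp: is_greedy_action_def is_arg_max_def not_less)
  then have "(\<Sum>a\<in>UNIV. Q $ s $ a * \<mu> $ s $ a) \<le> (\<Sum>a\<in>UNIV. Q $ s $ g s * \<mu> $ s $ a)"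
    using assms(1) by (intro sum_mono mult_right_mono) (auto simp: policies_def)
  also have "\<dots> = Q $ s $ g s"
    using assms(1) by (simp add: sum_distrib_left[symmetric] policies_def)
  also have "\<dots> = (\<Sum>a\<in>UNIV. Q $ s $ a * det_policy g $ s $ a)"
    by (simp add: det_policy_def axis_def if_distrib[of "(*) _"] cong: if_cong)
  finally show ?thesis .
qed

lemma greedy_is_fw_direction:
  fixes M :: "('s::finite, 'a::finite) mdp"
  assumes M: "finite_mdp M" and \<pi>: "\<pi> \<in> policies"
    and min: "is_arg_min (\<lambda>Q'. weighted_norm (occupancy M \<pi>) (Q' - action_value M \<pi>))
        (\<lambda>Q'. Q' \<in> agg_values \<phi>) Q"
    and greedy: "\<And>s. is_greedy_action Q s (g s)"
    and unique: "\<And>s. \<exists>!a. is_greedy_action Q s a"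
  shows "is_fw_direction M \<phi> \<pi> (det_policy g)"
proof -
  have g: "det_policy g \<in> agg_policies \<phi>"
    using min greedy unique by (intro det_policy_in_agg_policies) (auto simp: is_arg_min_def)
  have grad: "grad_objective M \<pi> \<bullet> \<mu>
      = (\<Sum>s\<in>UNIV. occupancy M \<pi> $ s * (\<Sum>a\<in>UNIV. Q $ s $ a * \<mu> $ s $ a))"
    if "\<mu> \<in> agg_policies \<phi>" for \<mu>
  proof -
    \<comment> \<open>Read as a vector, an aggregated policy is an aggregated value function, so it
      can serve as test direction for the projection.\<close>
    have "\<mu> \<in> agg_values \<phi>"
      using that unfolding agg_policies_def agg_values_def mem_Collect_eq by metis
    from weighted_projection_orthogonal[OF min this] show ?thesis
      by (simp add: policy_gradient_theorem[OF M \<pi>] inner_vec_def sum_distrib_left mult.assoc)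
  qed
  have "grad_objective M \<pi> \<bullet> \<mu> \<le> grad_objective M \<pi> \<bullet> det_policy g" if "\<mu> \<in> agg_policies \<phi>" for \<mu>
    unfolding grad[OF that] grad[OF g]
    using that unfolding agg_policies_def
    by (intro sum_mono mult_left_mono greedy_ge_policy greedy occupancy_nonneg[OF M \<pi>]) blast
  then show ?thesis
    using g by (auto simp: is_fw_direction_def is_arg_max_def inner_diff_right not_less)
qed

section \<open>Induction along the two runs\<close>

lemma policies_convex_combination:
  assumes "\<mu> \<in> policies" and "\<pi> \<in> policies" and "\<alpha> \<in> {0..1}"
  shows "\<alpha> *\<^sub>R \<mu> + (1 - \<alpha>) *\<^sub>R \<pi> \<in> policies"
  using assms by (auto simp: policies_def sum.distrib sum_distrib_left[symmetric])

theorem theorem8: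
  fixes M :: "('s::finite, 'a::finite) mdp"
    and \<phi> :: "'s \<Rightarrow> nat" and m :: nat
    and \<alpha> :: real and \<pi>\<^sub>1 :: "real ^ 'a ^ 's"
    and \<pi>F \<mu> \<pi>S Q :: "nat \<Rightarrow> real ^ 'a ^ 's" and g :: "nat \<Rightarrow> 's \<Rightarrow> 'a"
  assumes "finite_mdp M"
    and "\<phi> ` UNIV \<subseteq> {1..m}"
    and "\<alpha> \<in> {0..1}"
    and "\<pi>\<^sub>1 \<in> policies"
    and "frank_wolfe_run M \<alpha> \<pi>\<^sub>1 \<phi> \<pi>F \<mu>"
    and "soft_api_run M \<alpha> \<pi>\<^sub>1 \<phi> \<pi>S Q g"
    and "\<forall>t\<ge>1. \<exists>!\<nu>. is_fw_direction M \<phi> (\<pi>F t) \<nu>"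
    and "\<forall>t\<ge>1. \<forall>s. \<exists>!a. is_greedy_action (Q t) s a"
  shows "\<forall>t\<ge>1. \<pi>F t = \<pi>S t"
proof -
  \<comment> \<open>Membership in \<open>policies\<close> is carried along because the gradient
    formula is available only at policies.\<close>
  have "\<pi>F t = \<pi>S t \<and> \<pi>F t \<in> policies" if "t \<ge> 1" for t
    using that
  proof (induction t rule: dec_induct)
    case base
    show ?case
      using assms(4-6) by (simp add: frank_wolfe_run_def soft_api_run_def)
  next
    case (step t)
    have F: "is_fw_direction M \<phi> (\<pi>F t) (\<mu> (t + 1))" "\<pi>F (t + 1) = \<alpha> *\<^sub>R \<mu> (t + 1) + (1 - \<alpha>) *\<^sub>R \<pi>F t"
      using assms(5) step.hyps by (auto simp: frank_wolfe_run_def)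
    have S: "is_arg_min (\<lambda>Q'. weighted_norm (occupancy M (\<pi>S t)) (Q' - action_value M (\<pi>S t)))
        (\<lambda>Q'. Q' \<in> agg_values \<phi>) (Q t)"
      "\<And>s. is_greedy_action (Q t) s (g (t + 1) s)"
      "\<pi>S (t + 1) = \<alpha> *\<^sub>R det_policy (g (t + 1)) + (1 - \<alpha>) *\<^sub>R \<pi>S t"
      using assms(6) step.hyps by (auto simp: soft_api_run_def)
    have "is_fw_direction M \<phi> (\<pi>F t) (det_policy (g (t + 1)))"
      using step.IH step.hyps S(1,2) assms(8)
      by (intro greedy_is_fw_direction[OF assms(1), where Q = "Q t"]) metis+
    \<comment> \<open>Both are Frank-Wolfe directions at the common iterate, so uniqueness
      identifies them.\<close>
    then have "\<mu> (t + 1) = det_policy (g (t + 1))"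
      using F(1) assms(7) step.hyps by blast
    moreover have "\<mu> (t + 1) \<in> policies"
      using F(1) by (simp add: is_fw_direction_def is_arg_max_def agg_policies_def)
    ultimately show ?case
      using F(2) S(3) step.IH policies_convex_combination[OF _ _ assms(3)] by (metis Suc_eq_plus1)
  qed
  then show ?thesis by blast
qed

end
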